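(* There is an absolute constant $C>0$ such that for all positive integers $k_1\le k_2$, every pure state of a $(k_1+k_2)$-qubit system, divided into a set $A$ of $k_1$ qubits and a set $B$ of $k_2$ qubits, can be prepared from the all-zero state $|0\rangle^{\otimes(k_1+k_2)}$ by a circuit, without ancilla qubits, consisting of arbitrary unitaries within $A$, arbitrary unitaries within $B$, and at most $C\,2^{k_1}$ straddling CNOT gates. That is, entangling the two systems requires no more than $O(2^{k_1})$ straddling CNOT gates.
   Context: A straddling CNOT gate is a CNOT gate acting on one qubit of $A$ and one qubit of $B$ (either one may be the control). Unitaries acting only on the qubits of $A$, or only on the qubits of $B$, are free and are not counted. *)

theory Defs
  imports Complex_Main "Jordan_Normal_Form.Schur_Decomposition"
begin

(* The n-qubit space has computational basis |x_0 ... x_(n-1)>, enumerated by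
   sum_q x_q 2^(n-1-q) (qubit 0 is the most significant bit), so that appending
   registers corresponds to the usual Kronecker product.  For a (k1+k2)-qubit system
   the qubits 0,...,k1-1 form A and k1,...,k1+k2-1 form B. *)

definition pure_state :: "nat \<Rightarrow> complex vec \<Rightarrow> bool" where
  "pure_state n \<psi> \<longleftrightarrow> \<psi> \<in> carrier_vec (2 ^ n) \<and> \<psi> \<bullet>c \<psi> = 1"

definition zero_state :: "nat \<Rightarrow> complex vec" where
  "zero_state n = unit_vec (2 ^ n) 0"

definition unitary :: "nat \<Rightarrow> complex mat \<Rightarrow> bool" where
  "unitary d U \<longleftrightarrow> U \<in> carrier_mat d d \<and>
     mat_adjoint U * U = 1\<^sub>m d \<and> U * mat_adjoint U = 1\<^sub>m d"

definition kronecker :: "complex mat \<Rightarrow> complex mat \<Rightarrow> complex mat" where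
  "kronecker M N = mat (dim_row M * dim_row N) (dim_col M * dim_col N)
     (\<lambda>(i, j). M $$ (i div dim_row N, j div dim_col N) *
               N $$ (i mod dim_row N, j mod dim_col N))"

definition cnot_index :: "nat \<Rightarrow> nat \<Rightarrow> nat \<Rightarrow> nat \<Rightarrow> nat" where
  "cnot_index n c t x =
     (if bit x (n - 1 - c) then flip_bit (n - 1 - t) x else x)"

definition cnot_mat :: "nat \<Rightarrow> nat \<Rightarrow> nat \<Rightarrow> complex mat" where
  "cnot_mat n c t = mat (2 ^ n) (2 ^ n) (\<lambda>(i, j). if i = cnot_index n c t j then 1 else 0)"

(* CNOT c t has control c and target t. *)
datatype gate = Local_A "complex mat" | Local_B "complex mat" | CNOT nat nat

fun gate_ok :: "nat \<Rightarrow> nat \<Rightarrow> gate \<Rightarrow> bool" where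
  "gate_ok k1 k2 (Local_A U) \<longleftrightarrow> unitary (2 ^ k1) U"
| "gate_ok k1 k2 (Local_B V) \<longleftrightarrow> unitary (2 ^ k2) V"
| "gate_ok k1 k2 (CNOT c t) \<longleftrightarrow>
     (c \<in> {0..<k1} \<and> t \<in> {k1..<k1 + k2}) \<or> (t \<in> {0..<k1} \<and> c \<in> {k1..<k1 + k2})"

fun gate_mat :: "nat \<Rightarrow> nat \<Rightarrow> gate \<Rightarrow> complex mat" where
  "gate_mat k1 k2 (Local_A U) = kronecker U (1\<^sub>m (2 ^ k2))"
| "gate_mat k1 k2 (Local_B V) = kronecker (1\<^sub>m (2 ^ k1)) V"
| "gate_mat k1 k2 (CNOT c t) = cnot_mat (k1 + k2) c t"

fun is_cnot :: "gate \<Rightarrow> bool" where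
  "is_cnot (CNOT c t) \<longleftrightarrow> True"
| "is_cnot _ \<longleftrightarrow> False"

definition bipartite_circuit :: "nat \<Rightarrow> nat \<Rightarrow> gate list \<Rightarrow> bool" where
  "bipartite_circuit k1 k2 gs \<longleftrightarrow> (\<forall>g \<in> set gs. gate_ok k1 k2 g)"

(* The head of the list acts first. *)
definition run_circuit :: "nat \<Rightarrow> nat \<Rightarrow> gate list \<Rightarrow> complex vec \<Rightarrow> complex vec" where
  "run_circuit k1 k2 gs \<psi> = fold (\<lambda>g \<phi>. gate_mat k1 k2 g *\<^sub>v \<phi>) gs \<psi>"

(* In a circuit satisfying bipartite_circuit every CNOT is straddling. *)
definition straddling_count :: "gate list \<Rightarrow> nat" where
  "straddling_count gs = length (filter is_cnot gs)"

end

theory Submission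
  imports Defs "Jordan_Normal_Form.Spectral_Radius"
begin

text \<open>Read a state of A and B as a matrix M of amplitudes with rows indexed by A and columns by B.
A local unitary on A multiplies M from the left, one on B multiplies it from the right (transposed),
so by the singular value decomposition (the Schmidt decomposition of the state) it suffices to
prepare the diagonal matrix of the singular values. Its entries are the amplitudes of a state of A
alone; after preparing that state locally, CNOT gates from the qubits of A into distinct qubits
of B copy the index i of A into B. Thus even k1 straddling gates are enough.\<close>

section \<open>Adjoints and unitary matrices\<close>

lemma mat_adjoint_dim [simp]:
  "dim_row (mat_adjoint A) = dim_col A" "dim_col (mat_adjoint A) = dim_row A"
  by (simp_all add: mat_adjoint_def)

lemma mat_adjoint_carrier [simp]:
  "A \<in> carrier_mat m n \<Longrightarrow> mat_adjoint A \<in> carrier_mat n m"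
  by (intro carrier_matI) auto

lemma mat_adjoint_index [simp]:
  fixes A :: "complex mat"
  assumes "i < dim_col A" "j < dim_row A"
  shows "mat_adjoint A $$ (i, j) = cnj (A $$ (j, i))"
  using assms by (simp add: mat_adjoint_def mat_of_rows_def)

lemma mat_adjoint_adjoint [simp]:
  fixes A :: "complex mat"
  shows "mat_adjoint (mat_adjoint A) = A"
  by (rule eq_matI) auto

lemma mat_adjoint_mult:
  fixes A B :: "complex mat"
  assumes "A \<in> carrier_mat m n" "B \<in> carrier_mat n p"
  shows "mat_adjoint (A * B) = mat_adjoint B * mat_adjoint A"
  using assms by (intro eq_matI) (auto simp: scalar_prod_def mult.commute intro!: sum.cong)

lemma mat_adjoint_four_block:
  fixes A D :: "complex mat"
  assumes "A \<in> carrier_mat m m" "D \<in> carrier_mat n n"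
  shows "mat_adjoint (four_block_mat A (0\<^sub>m m n) (0\<^sub>m n m) D)
       = four_block_mat (mat_adjoint A) (0\<^sub>m m n) (0\<^sub>m n m) (mat_adjoint D)"
  using assms by (intro eq_matI) auto

lemma mult_four_block_diag:
  fixes A D :: "complex mat"
  assumes "A \<in> carrier_mat m m" "D \<in> carrier_mat n n" "A' \<in> carrier_mat m m" "D' \<in> carrier_mat n n"
  shows "four_block_mat A (0\<^sub>m m n) (0\<^sub>m n m) D * four_block_mat A' (0\<^sub>m m n) (0\<^sub>m n m) D'
       = four_block_mat (A * A') (0\<^sub>m m n) (0\<^sub>m n m) (D * D')"
  using assms by (subst mult_four_block_mat[of _ m m _ n _ n _ _ m _ n]) auto

lemma mat_adjoint_one [simp]: "mat_adjoint (1\<^sub>m n :: complex mat) = 1\<^sub>m n"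
  by (rule eq_matI) auto

text \<open>For square matrices over a field a left inverse is also a right inverse, so one of the
  two unitarity equations implies the other.\<close>

lemma unitaryI:
  assumes "U \<in> carrier_mat d d" "mat_adjoint U * U = 1\<^sub>m d"
  shows "unitary d U"
  using assms mat_mult_left_right_inverse[of "mat_adjoint U" d U] by (simp add: unitary_def)

lemma unitary_one: "unitary d (1\<^sub>m d)"
  by (intro unitaryI) auto

lemma unitary_mult:
  assumes "unitary d U" "unitary d V"
  shows "unitary d (U * V)"
proof (rule unitaryI)
  have U: "U \<in> carrier_mat d d" and V: "V \<in> carrier_mat d d"
    using assms by (auto simp: unitary_def)
  then show "U * V \<in> carrier_mat d d" by simp
  have "mat_adjoint (U * V) * (U * V) = mat_adjoint V * (mat_adjoint U * (U * V))"
    using U V by (simp add: mat_adjoint_mult[of _ d d _ d] assoc_mult_mat[of _ d d _ d _ d])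
  also have "mat_adjoint U * (U * V) = (mat_adjoint U * U) * V"
    using U V by (simp add: assoc_mult_mat[of _ d d _ d _ d])
  also have "\<dots> = V" using V assms by (simp add: unitary_def)
  also have "mat_adjoint V * V = 1\<^sub>m d" using assms by (simp add: unitary_def)
  finally show "mat_adjoint (U * V) * (U * V) = 1\<^sub>m d" .
qed

lemma unitary_adjoint:
  assumes "unitary d U"
  shows "unitary d (mat_adjoint U)"
  using assms by (simp add: unitary_def)

lemma unitary_four_block:
  assumes "unitary m U" "unitary n V"
  shows "unitary (m + n) (four_block_mat U (0\<^sub>m m n) (0\<^sub>m n m) V)"
  using assms unfolding unitary_def
  by (auto simp: mat_adjoint_four_block mult_four_block_diag)

section \<open>Orthonormal families and their completion to bases\<close>

definition orthonormal_on :: "nat \<Rightarrow> nat set \<Rightarrow> (nat \<Rightarrow> complex vec) \<Rightarrow> bool" where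
  "orthonormal_on n S f \<longleftrightarrow> (\<forall>i\<in>S. f i \<in> carrier_vec n) \<and>
     (\<forall>i\<in>S. \<forall>j\<in>S. f i \<bullet>c f j = (if i = j then 1 else 0))"

lemma cscalar_prod_self:
  fixes v :: "complex vec"
  shows "v \<bullet>c v = of_real (\<Sum>i<dim_vec v. (cmod (v $ i))\<^sup>2)"
  by (simp add: scalar_prod_def atLeast0LessThan complex_norm_square flip: of_real_power)

text \<open>The number \<open>r\<close> is the Euclidean norm of \<open>v\<close>. Keeping it as a
  real witness lets the norms of matrix rows serve later as singular values.\<close>

lemma cscalar_prod_normalize:
  fixes v :: "complex vec"
  assumes "v \<noteq> 0\<^sub>v (dim_vec v)"
  obtains r where "r > 0" "v \<bullet>c v = of_real (r\<^sup>2)"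
    "(of_real (1 / r) \<cdot>\<^sub>v v) \<bullet>c (of_real (1 / r) \<cdot>\<^sub>v v) = 1"
proof -
  define q where "q = (\<Sum>i<dim_vec v. (cmod (v $ i))\<^sup>2)"
  have q: "v \<bullet>c v = of_real q" by (simp add: cscalar_prod_self q_def)
  have "v \<bullet>c v \<noteq> 0" using assms conjugate_square_eq_0_vec[of v "dim_vec v"] by auto
  then have "q \<noteq> 0" using q by auto
  moreover have "q \<ge> 0" by (auto simp: q_def intro: sum_nonneg)
  ultimately have "q > 0" by simp
  define r where "r = sqrt q"
  have r: "r > 0" "r\<^sup>2 = q" using \<open>q > 0\<close> by (auto simp: r_def)
  have "(of_real (1 / r) \<cdot>\<^sub>v v) \<bullet>c (of_real (1 / r) \<cdot>\<^sub>v v) = of_real (1 / r) * (of_real (1 / r) * (v \<bullet>c v))"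
    by (simp add: conjugate_smult_vec)
  also have "\<dots> = of_real ((1 / r) * ((1 / r) * q))" by (simp add: q)
  also have "(1 / r) * ((1 / r) * q) = 1" using r by (auto simp: power2_eq_square)
  finally show ?thesis using r q by (intro that[of r]) auto
qed

lemma cscalar_prod_commute:
  fixes v w :: "complex vec"
  assumes "v \<in> carrier_vec n" "w \<in> carrier_vec n"
  shows "w \<bullet>c v = cnj (v \<bullet>c w)"
  using assms by (auto simp: scalar_prod_def mult.commute intro!: sum.cong)

text \<open>The vectors conjugate (f i), padded with zero rows, form a singular square matrix.\<close>

lemma exists_orthogonal_unit_vector:
  assumes f: "\<forall>i\<in>S. f i \<in> carrier_vec n" and S: "S \<subseteq> {..<n}" "k \<in> {..<n} - S"
  obtains v :: "complex vec" where "v \<in> carrier_vec n" "v \<bullet>c v = 1" "\<forall>i\<in>S. v \<bullet>c f i = 0"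
proof -
  define A where "A = mat\<^sub>r n n (\<lambda>i. if i = k then 0\<^sub>v n else if i \<in> S then conjugate (f i) else 0\<^sub>v n)"
  have A: "A \<in> carrier_mat n n" by (simp add: A_def)
  have "det A = 0" unfolding A_def using S f by (intro det_row_0) auto
  then obtain v where v: "v \<in> carrier_vec n" "v \<noteq> 0\<^sub>v n" "A *\<^sub>v v = 0\<^sub>v n"
    using det_0_iff_vec_prod_zero_field[OF A] by auto
  have orth: "v \<bullet>c f i = 0" if "i \<in> S" for i
  proof -
    have i: "i < n" "i \<noteq> k" "f i \<in> carrier_vec n" using that S f by auto
    have "0 = (A *\<^sub>v v) $ i" using v(3) i by simp
    also have "\<dots> = row A i \<bullet> v" using A i by simp
    also have "row A i = conjugate (f i)"
      using i that by (auto simp: A_def intro!: eq_vecI)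
    also have "conjugate (f i) \<bullet> v = v \<bullet>c f i"
      using i v by (intro comm_scalar_prod[of _ n]) auto
    finally show ?thesis by simp
  qed
  obtain r where "r > 0" and r: "(of_real (1 / r) \<cdot>\<^sub>v v) \<bullet>c (of_real (1 / r) \<cdot>\<^sub>v v) = 1"
    using cscalar_prod_normalize[of v] v by auto
  show ?thesis
  proof (rule that[OF _ r])
    show "of_real (1 / r) \<cdot>\<^sub>v v \<in> carrier_vec n" using v by simp
    show "\<forall>i\<in>S. (of_real (1 / r) \<cdot>\<^sub>v v) \<bullet>c f i = 0"
      using orth v f by (auto simp: carrier_vecD)
  qed
qed

text \<open>Induction on the number of missing indices: each step fills one free index with a unit
  vector orthogonal to the family so far. Old vectors keep their indices, so the completed basis
  stays aligned with the rows or columns it came from.\<close>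

lemma orthonormal_on_extend:
  assumes "orthonormal_on n S f" "S \<subseteq> {..<n}"
  obtains g where "orthonormal_on n {..<n} g" "\<forall>i\<in>S. g i = f i"
proof -
  have "\<exists>g. orthonormal_on n {..<n} g \<and> (\<forall>i\<in>S. g i = f i)"
    using assms
  proof (induction "card ({..<n} - S)" arbitrary: S f)
    case 0
    then have "S = {..<n}" by auto
    then show ?case using 0 by auto
  next
    case (Suc d)
    then obtain k where k: "k \<in> {..<n} - S" by (metis card.empty ex_in_conv nat.distinct(1))
    obtain v where v: "v \<in> carrier_vec n" "v \<bullet>c v = 1" "\<forall>i\<in>S. v \<bullet>c f i = 0"
      using exists_orthogonal_unit_vector[of S f n k] Suc.prems k by (auto simp: orthonormal_on_def)
    have v': "f i \<bullet>c v = 0" if "i \<in> S" for i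
      using cscalar_prod_commute[of v n "f i"] v Suc.prems that by (auto simp: orthonormal_on_def)
    have "orthonormal_on n (insert k S) (f(k := v))"
      using Suc.prems v v' k by (auto simp: orthonormal_on_def)
    moreover have "d = card ({..<n} - insert k S)"
      using Suc.hyps(2) k by (metis Diff_insert card_Diff_singleton diff_Suc_1)
    ultimately obtain g where "orthonormal_on n {..<n} g" "\<forall>i\<in>insert k S. g i = (f(k := v)) i"
      using Suc.hyps(1)[of "insert k S" "f(k := v)"] Suc.prems k by auto
    then show ?case using k by (intro exI[of _ g]) auto
  qed
  then show ?thesis using that by auto
qed

lemma unitary_of_orthonormal:
  assumes "orthonormal_on n {..<n} g"
  shows "unitary n (mat n n (\<lambda>(i, j). g j $ i))"
proof (rule unitaryI)
  have "(\<Sum>k = 0..<n. cnj (g i $ k) * g j $ k) = (if i = j then 1 else 0)" if "i < n" "j < n" for i j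
  proof -
    have "(if i = j then 1 else 0) = g j \<bullet>c g i" "g i \<in> carrier_vec n"
      using assms that by (auto simp: orthonormal_on_def)
    then show ?thesis by (simp add: scalar_prod_def mult.commute)
  qed
  then show "mat_adjoint (mat n n (\<lambda>(i, j). g j $ i)) * mat n n (\<lambda>(i, j). g j $ i) = 1\<^sub>m n"
    by (intro eq_matI) (auto simp: scalar_prod_def)
qed auto

text \<open>Complete \<open>v\<close>, placed at index 0, to an orthonormal basis and take the basis
  as columns. This serves twice: for the deflation step of the spectral theorem, and for preparing a
  state of A from its zero state by one local unitary.\<close>

lemma unitary_first_column:
  assumes "v \<in> carrier_vec n" "v \<bullet>c v = 1" "0 < n"
  obtains U where "unitary n U" "col U 0 = v"
proof -
  have "orthonormal_on n {0} (\<lambda>_. v)" using assms by (simp add: orthonormal_on_def)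
  then obtain g where g: "orthonormal_on n {..<n} g" "g 0 = v"
    using orthonormal_on_extend[of n "{0}" "\<lambda>_. v"] assms by auto
  show ?thesis
    using assms g unitary_of_orthonormal[OF g(1)]
    by (intro that[of "mat n n (\<lambda>(i, j). g j $ i)"]) (auto intro!: eq_vecI)
qed

section \<open>The spectral theorem for Hermitian matrices\<close>

text \<open>Deflation: in an orthonormal basis that begins with an eigenvector, the first column is
  zero below the diagonal, and Hermitian symmetry clears the first row too. What remains is a
  smaller Hermitian block, handled by induction.\<close>

lemma hermitian_unitarily_diagonalizable:
  assumes "H \<in> carrier_mat n n" "mat_adjoint H = H"
  obtains U where "unitary n U" "diagonal_mat (mat_adjoint U * H * U)"
proof -
  have "\<exists>U. unitary n U \<and> diagonal_mat (mat_adjoint U * H * U)"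
    using assms
  proof (induction n arbitrary: H)
    case 0
    then show ?case by (intro exI[of _ "1\<^sub>m 0"]) (auto simp: unitary_one diagonal_mat_def)
  next
    case (Suc n)
    let ?N = "Suc n"
    note H = Suc.prems
    \<comment> \<open>A complex matrix of positive size has nonempty spectrum, which supplies an
      eigenvector.\<close>
    obtain e v where v: "v \<in> carrier_vec ?N" "v \<noteq> 0\<^sub>v ?N" "H *\<^sub>v v = e \<cdot>\<^sub>v v"
      using spectrum_non_empty[OF H(1)] H(1) by (auto simp: spectrum_def eigenvalue_def eigenvector_def)
    obtain r where r: "r > 0" "(of_real (1 / r) \<cdot>\<^sub>v v) \<bullet>c (of_real (1 / r) \<cdot>\<^sub>v v) = 1"
      using cscalar_prod_normalize[of v] v by auto
    define w where "w = of_real (1 / r) \<cdot>\<^sub>v v"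
    have w: "w \<in> carrier_vec ?N" "w \<bullet>c w = 1" "H *\<^sub>v w = e \<cdot>\<^sub>v w"
      using v r H(1) unfolding w_def
      by (auto simp: mult_mat_vec[of H ?N ?N] smult_smult_assoc mult.commute)
    obtain W where W: "unitary ?N W" "col W 0 = w"
      using unitary_first_column[OF w(1,2)] by auto
    have Wc: "W \<in> carrier_mat ?N ?N" using W by (simp add: unitary_def)
    define H1 where "H1 = mat_adjoint W * H * W"
    have H1c: "H1 \<in> carrier_mat ?N ?N" using Wc H unfolding H1_def by (intro carrier_matI) auto
    have H1adj: "mat_adjoint H1 = H1" using Wc H
      by (simp add: H1_def mat_adjoint_mult[of _ ?N ?N _ ?N] assoc_mult_mat[of _ ?N ?N _ ?N _ ?N])
    \<comment> \<open>Since \<open>w\<close> is the first column of \<open>W\<close>, the adjoint of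
      \<open>W\<close> sends the eigenvector \<open>w\<close> back to the first unit vector.\<close>
    have "col H1 0 = (mat_adjoint W * H) *\<^sub>v col W 0"
      unfolding H1_def using Wc H by (intro col_mult2[of _ ?N ?N _ ?N]) auto
    also have "\<dots> = mat_adjoint W *\<^sub>v (H *\<^sub>v w)"
      using Wc H w by (simp add: W assoc_mult_mat_vec[of _ ?N ?N _ ?N])
    also have "\<dots> = e \<cdot>\<^sub>v (mat_adjoint W *\<^sub>v col W 0)"
      using Wc w by (simp add: W mult_mat_vec[of _ ?N ?N])
    also have "mat_adjoint W *\<^sub>v col W 0 = col (mat_adjoint W * W) 0"
      using Wc by (intro col_mult2[of _ ?N ?N _ ?N, symmetric]) auto
    also have "mat_adjoint W * W = 1\<^sub>m ?N" using W by (simp add: unitary_def)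
    finally have col0: "col H1 0 = e \<cdot>\<^sub>v unit_vec ?N 0" by simp
    have z1: "H1 $$ (Suc i, 0) = 0" if "i < n" for i
      using arg_cong[OF col0, of "\<lambda>x. x $ Suc i"] that H1c by simp
    \<comment> \<open>Hermitian symmetry carries the zeros of the first column over to the first
      row.\<close>
    have z2: "H1 $$ (0, Suc i) = 0" if "i < n" for i
    proof -
      have "H1 $$ (0, Suc i) = mat_adjoint H1 $$ (0, Suc i)" by (simp add: H1adj)
      then show ?thesis using z1[OF that] H1c that by simp
    qed
    define H' where "H' = mat n n (\<lambda>(i, j). H1 $$ (Suc i, Suc j))"
    define h where "h = mat 1 1 (\<lambda>_. H1 $$ (0, 0))"
    have H'c: "H' \<in> carrier_mat n n" and hc: "h \<in> carrier_mat 1 1" by (auto simp: H'_def h_def)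
    have block: "H1 = four_block_mat h (0\<^sub>m 1 n) (0\<^sub>m n 1) H'"
    proof (rule eq_matI)
      fix i j
      assume "i < dim_row (four_block_mat h (0\<^sub>m 1 n) (0\<^sub>m n 1) H')"
        "j < dim_col (four_block_mat h (0\<^sub>m 1 n) (0\<^sub>m n 1) H')"
      then have "i < ?N" "j < ?N" using H'c hc by auto
      then show "H1 $$ (i, j) = four_block_mat h (0\<^sub>m 1 n) (0\<^sub>m n 1) H' $$ (i, j)"
        using z1 z2 H'c hc by (cases i; cases j) (auto simp: H'_def h_def)
    qed (use H1c H'c hc in auto)
    have "mat_adjoint H' = H'"
    proof (rule eq_matI)
      fix i j assume "i < dim_row H'" "j < dim_col H'"
      then have ij: "i < n" "j < n" by (auto simp: H'_def)
      have "mat_adjoint H1 $$ (Suc i, Suc j) = H1 $$ (Suc i, Suc j)" by (simp add: H1adj)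
      then show "mat_adjoint H' $$ (i, j) = H' $$ (i, j)" using ij H1c by (simp add: H'_def)
    qed (auto simp: H'_def)
    then obtain U' where U': "unitary n U'" "diagonal_mat (mat_adjoint U' * H' * U')"
      using Suc.IH[OF H'c] by blast
    have U'c: "U' \<in> carrier_mat n n" using U' by (simp add: unitary_def)
    \<comment> \<open>\<open>V\<close> fixes the first coordinate, so conjugating by it leaves the
      entry \<open>h\<close> alone and diagonalizes only the block \<open>H'\<close>.\<close>
    define V where "V = four_block_mat (1\<^sub>m 1) (0\<^sub>m 1 n) (0\<^sub>m n 1) U'"
    have V: "unitary ?N V" using unitary_four_block[OF unitary_one[of 1] U'(1)] by (simp add: V_def)
    have Vc: "V \<in> carrier_mat ?N ?N" using V by (simp add: unitary_def)
    have "mat_adjoint (W * V) * H * (W * V) = mat_adjoint V * H1 * V"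
      using Wc Vc H
      by (simp add: H1_def mat_adjoint_mult[of _ ?N ?N _ ?N] assoc_mult_mat[of _ ?N ?N _ ?N _ ?N]
          mult_carrier_mat[of _ ?N ?N _ ?N])
    also have "\<dots> = four_block_mat h (0\<^sub>m 1 n) (0\<^sub>m n 1) (mat_adjoint U' * H' * U')"
      using U'c H'c hc by (simp add: V_def block mat_adjoint_four_block mult_four_block_diag mult_carrier_mat[of _ n n _ n])
    finally have "diagonal_mat (mat_adjoint (W * V) * H * (W * V))"
      using U'(2) U'c H'c hc by (auto simp: diagonal_mat_def)
    then show ?case using unitary_mult[OF W(1) V] by blast
  qed
  then show ?thesis using that by auto
qed

section \<open>The singular value decomposition\<close>

text \<open>A unitary \<open>U\<close> diagonalizing \<open>M * mat_adjoint M\<close> makes the rows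
  of \<open>N = mat_adjoint U * M\<close> pairwise orthogonal. Their norms are the singular values,
  and the normalized nonzero rows extend to the rows of \<open>V\<close>. The last conclusion is
  invariance of the squared Frobenius norm, which will say that the singular values of a state form
  a unit vector.\<close>

lemma singular_value_decomposition:
  fixes M :: "complex mat"
  assumes M: "M \<in> carrier_mat m n" and mn: "m \<le> n"
  obtains U V s where "unitary m U" "unitary n V"
    "M = U * mat m n (\<lambda>(i, j). if i = j then s i else 0) * V"
    "(\<Sum>i<m. s i * cnj (s i)) = (\<Sum>j<n. col M j \<bullet>c col M j)"
proof -
  have Ma: "mat_adjoint M \<in> carrier_mat n m" using M by simp
  have "mat_adjoint (M * mat_adjoint M) = M * mat_adjoint M"
    using mat_adjoint_mult[OF M Ma] by simp
  then obtain U where U: "unitary m U" "diagonal_mat (mat_adjoint U * (M * mat_adjoint M) * U)"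
    using hermitian_unitarily_diagonalizable[of "M * mat_adjoint M" m] M by auto
  have Uc: "U \<in> carrier_mat m m" using U by (simp add: unitary_def)
  define N where "N = mat_adjoint U * M"
  have Nc: "N \<in> carrier_mat m n" using Uc M unfolding N_def by (intro carrier_matI) auto
  have Uac: "mat_adjoint U \<in> carrier_mat m m" using Uc by simp
  \<comment> \<open>The Gram matrix of the rows of \<open>N\<close> is the diagonalized matrix
    itself, so its vanishing off-diagonal entries are the orthogonality of the rows.\<close>
  have NaN: "N * mat_adjoint N = mat_adjoint U * (M * mat_adjoint M) * U"
  proof -
    have "mat_adjoint N = mat_adjoint M * U" using mat_adjoint_mult[OF Uac M] by (simp add: N_def)
    then have "N * mat_adjoint N = (mat_adjoint U * M) * (mat_adjoint M * U)" by (simp add: N_def)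
    also have "\<dots> = mat_adjoint U * (M * (mat_adjoint M * U))"
      using Uac M Ma Uc by (intro assoc_mult_mat) auto
    also have "M * (mat_adjoint M * U) = M * mat_adjoint M * U"
      using M Ma Uc by (intro assoc_mult_mat[symmetric]) auto
    also have "mat_adjoint U * (M * mat_adjoint M * U) = mat_adjoint U * (M * mat_adjoint M) * U"
      using M Ma Uc Uac by (intro assoc_mult_mat[symmetric]) auto
    finally show ?thesis .
  qed
  have row_eq: "row N i \<bullet>c row N j = (N * mat_adjoint N) $$ (i, j)" if "i < m" "j < m" for i j
    using that Nc by (auto simp: scalar_prod_def intro!: sum.cong)
  have orth: "row N i \<bullet>c row N j = 0" if "i < m" "j < m" "i \<noteq> j" for i j
    using U(2) that row_eq[OF that(1,2)] Nc unfolding NaN[symmetric] by (auto simp: diagonal_mat_def)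
  \<comment> \<open>Zero rows cannot be normalized, so only the others enter the family to be
    completed.\<close>
  define S where "S = {i. i < m \<and> row N i \<noteq> 0\<^sub>v n}"
  have "\<exists>r. r > 0 \<and> row N i \<bullet>c row N i = of_real (r\<^sup>2) \<and>
      (of_real (1 / r) \<cdot>\<^sub>v row N i) \<bullet>c (of_real (1 / r) \<cdot>\<^sub>v row N i) = 1" if "i \<in> S" for i
  proof -
    have "row N i \<noteq> 0\<^sub>v (dim_vec (row N i))" using that Nc by (simp add: S_def)
    then show ?thesis by (rule cscalar_prod_normalize) blast
  qed
  then obtain r where r: "\<And>i. i \<in> S \<Longrightarrow> r i > 0"
    "\<And>i. i \<in> S \<Longrightarrow> row N i \<bullet>c row N i = of_real ((r i)\<^sup>2)"
    "\<And>i. i \<in> S \<Longrightarrow> (of_real (1 / r i) \<cdot>\<^sub>v row N i) \<bullet>c (of_real (1 / r i) \<cdot>\<^sub>v row N i) = 1"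
    by metis
  define f where "f i = complex_of_real (1 / r i) \<cdot>\<^sub>v row N i" for i
  have "f i \<bullet>c f j = 0" if "i \<in> S" "j \<in> S" "i \<noteq> j" for i j
    using orth[of i j] that Nc by (auto simp: f_def S_def conjugate_smult_vec)
  then have "orthonormal_on n S f"
    using r(3) Nc unfolding orthonormal_on_def by (auto simp: f_def)
  \<comment> \<open>Here \<open>m \<le> n\<close> enters: each row index must also be a valid index
    of a basis of the n-dimensional row space.\<close>
  moreover have "S \<subseteq> {..<n}" using mn by (auto simp: S_def)
  ultimately obtain g where g: "orthonormal_on n {..<n} g" "\<forall>i\<in>S. g i = f i"
    by (rule orthonormal_on_extend)
  \<comment> \<open>The basis vectors are the rows of \<open>V\<close>, not its columns. Their
    orthonormality therefore reads \<open>V * mat_adjoint V = 1\<close>, which gives unitarity of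
    the adjoint first.\<close>
  define V where "V = mat n n (\<lambda>(i, j). g i $ j)"
  have Vc: "V \<in> carrier_mat n n" by (simp add: V_def)
  have V: "unitary n V"
  proof -
    have "(\<Sum>k = 0..<n. g i $ k * cnj (g j $ k)) = (if i = j then 1 else 0)" if "i < n" "j < n" for i j
    proof -
      have "(if i = j then 1 else 0) = g i \<bullet>c g j" "g j \<in> carrier_vec n"
        using g(1) that by (auto simp: orthonormal_on_def)
      then show ?thesis by (simp add: scalar_prod_def)
    qed
    then have "mat_adjoint (mat_adjoint V) * mat_adjoint V = 1\<^sub>m n"
      by (intro eq_matI) (auto simp: scalar_prod_def V_def)
    then show ?thesis using unitaryI[of "mat_adjoint V" n] unitary_adjoint[of n "mat_adjoint V"] Vc by auto
  qed
  \<comment> \<open>A zero row gets singular value 0, which cancels whatever vector the completion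
    put at that index.\<close>
  define s where "s i = (if i \<in> S then complex_of_real (r i) else 0)" for i
  define D where "D = mat m n (\<lambda>(i, j). if i = j then s i else 0)"
  have Dc: "D \<in> carrier_mat m n" by (simp add: D_def)
  have "N = D * V"
  proof (rule eq_matI)
    fix i j assume "i < dim_row (D * V)" "j < dim_col (D * V)"
    then have ij: "i < m" "j < n" using Vc Dc by auto
    have "(D * V) $$ (i, j) = (\<Sum>k = 0..<n. (if i = k then s i else 0) * g k $ j)"
      using ij mn by (simp add: D_def V_def scalar_prod_def)
    also have "\<dots> = (\<Sum>k = 0..<n. if i = k then s i * g i $ j else 0)"
      by (intro sum.cong) auto
    also have "\<dots> = s i * g i $ j" using ij mn by simp
    also have "\<dots> = N $$ (i, j)"
    proof (cases "i \<in> S")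
      case True
      then show ?thesis using g(2) r(1)[OF True] ij Nc by (simp add: s_def f_def)
    next
      case False
      then have "row N i $ j = 0" using ij by (simp add: S_def)
      then show ?thesis using False ij Nc by (simp add: s_def)
    qed
    finally show "N $$ (i, j) = (D * V) $$ (i, j)" by simp
  qed (use Nc Dc Vc in auto)
  have "M = U * mat_adjoint U * M" using U(1) M by (simp add: unitary_def)
  also have "\<dots> = U * N" using Uc Uac M by (simp add: N_def assoc_mult_mat[of U m m _ m M n])
  also have "\<dots> = U * D * V" unfolding \<open>N = D * V\<close> using Uc Dc Vc by simp
  finally have "M = U * D * V" .
  \<comment> \<open>Both sides are traces: the squared row norms of \<open>N\<close> sum to the
    trace of \<open>mat_adjoint N * N\<close>, and this product equals
    \<open>mat_adjoint M * M\<close> because \<open>U\<close> is unitary.\<close>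
  moreover have "(\<Sum>i<m. s i * cnj (s i)) = (\<Sum>j<n. col M j \<bullet>c col M j)"
  proof -
    have "s i * cnj (s i) = row N i \<bullet>c row N i" if "i < m" for i
    proof (cases "i \<in> S")
      case True
      then show ?thesis using r(2)[OF True] by (simp add: s_def power2_eq_square)
    next
      case False
      then have "row N i = 0\<^sub>v n" using that by (simp add: S_def)
      then show ?thesis using False by (simp add: s_def)
    qed
    then have "(\<Sum>i<m. s i * cnj (s i)) = (\<Sum>i<m. \<Sum>j<n. N $$ (i, j) * cnj (N $$ (i, j)))"
      using Nc by (auto simp: scalar_prod_def atLeast0LessThan intro!: sum.cong)
    also have "\<dots> = (\<Sum>j<n. \<Sum>i<m. N $$ (i, j) * cnj (N $$ (i, j)))" by (rule sum.swap)
    also have "\<dots> = (\<Sum>j<n. (mat_adjoint N * N) $$ (j, j))"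
      using Nc by (intro sum.cong) (auto simp: scalar_prod_def atLeast0LessThan mult.commute)
    also have "mat_adjoint N * N = mat_adjoint M * M"
    proof -
      have "mat_adjoint N * N = mat_adjoint M * U * (mat_adjoint U * M)"
        using mat_adjoint_mult[OF Uac M] by (simp add: N_def)
      also have "\<dots> = mat_adjoint M * (U * (mat_adjoint U * M))"
        using Ma Uc Uac M by (intro assoc_mult_mat) auto
      also have "U * (mat_adjoint U * M) = U * mat_adjoint U * M"
        using Uc Uac M by (intro assoc_mult_mat[symmetric]) auto
      also have "\<dots> = M" using U(1) M by (simp add: unitary_def)
      finally show ?thesis .
    qed
    also have "(\<Sum>j<n. (mat_adjoint M * M) $$ (j, j)) = (\<Sum>j<n. col M j \<bullet>c col M j)"
      using M by (intro sum.cong) (auto simp: scalar_prod_def mult.commute)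
    finally show ?thesis .
  qed
  ultimately show ?thesis using that U(1) V by (simp add: D_def)
qed

section \<open>States as amplitude matrices and the action of local gates\<close>

text \<open>Row-major order matches the Kronecker convention: the high bits of the index, belonging
  to A, select the row, and the low bits, belonging to B, the column.\<close>

definition vec_of_mat :: "complex mat \<Rightarrow> complex vec" where
  "vec_of_mat M = vec (dim_row M * dim_col M) (\<lambda>x. M $$ (x div dim_col M, x mod dim_col M))"

lemma div_mod_less:
  fixes x :: nat
  assumes "x < m * n"
  shows "x div n < m" "x mod n < n"
  using assms by (cases "n = 0"; simp add: less_mult_imp_div_less)+

lemma sum_lessThan_mult:
  fixes f :: "nat \<Rightarrow> 'a::comm_monoid_add"
  shows "(\<Sum>x<m * n. f x) = (\<Sum>i<m. \<Sum>j<n. f (i * n + j))"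
proof -
  have "(\<Sum>x<m * n. f x) = (\<Sum>i<m. sum f {i * n..<i * n + n})" by (simp add: sum.nat_group)
  also have "\<dots> = (\<Sum>i<m. \<Sum>j<n. f (i * n + j))"
  proof (rule sum.cong)
    fix i
    show "sum f {i * n..<i * n + n} = (\<Sum>j<n. f (i * n + j))"
      using sum.shift_bounds_nat_ivl[of f 0 "i * n" n]
      by (simp add: add.commute atLeast0LessThan)
  qed simp
  finally show ?thesis .
qed

text \<open>The row-major vectorization identity. A transpose appears rather than an adjoint because
  \<open>V\<close> is summed against the column index of \<open>M\<close> without
  conjugation.\<close>

lemma kronecker_mult_vec_of_mat:
  assumes U: "U \<in> carrier_mat m m" and V: "V \<in> carrier_mat n n" and M: "M \<in> carrier_mat m n"
  shows "kronecker U V *\<^sub>v vec_of_mat M = vec_of_mat (U * M * transpose_mat V)"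
proof (rule eq_vecI)
  fix x assume "x < dim_vec (vec_of_mat (U * M * transpose_mat V))"
  then have x: "x < m * n" using assms by (simp add: vec_of_mat_def)
  define a b where "a = x div n" and "b = x mod n"
  have ab: "a < m" "b < n" using div_mod_less[OF x] by (auto simp: a_def b_def)
  have "(kronecker U V *\<^sub>v vec_of_mat M) $ x
      = (\<Sum>y<m * n. U $$ (a, y div n) * V $$ (b, y mod n) * M $$ (y div n, y mod n))"
    using x assms by (simp add: kronecker_def vec_of_mat_def scalar_prod_def atLeast0LessThan a_def b_def)
  \<comment> \<open>The index of the product space splits into quotient and remainder, turning one
    sum into a double sum over A and B.\<close>
  also have "\<dots> = (\<Sum>i<m. \<Sum>j<n. U $$ (a, i) * V $$ (b, j) * M $$ (i, j))"
    unfolding sum_lessThan_mult by (intro sum.cong) auto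
  also have "\<dots> = (\<Sum>j<n. \<Sum>i<m. U $$ (a, i) * V $$ (b, j) * M $$ (i, j))" by (rule sum.swap)
  also have "\<dots> = (\<Sum>j<n. (\<Sum>i<m. U $$ (a, i) * M $$ (i, j)) * V $$ (b, j))"
    by (simp add: sum_distrib_right sum_distrib_left mult_ac)
  also have "\<dots> = (U * M * transpose_mat V) $$ (a, b)"
    using ab assms by (simp add: scalar_prod_def atLeast0LessThan del: assoc_mult_mat)
  also have "\<dots> = vec_of_mat (U * M * transpose_mat V) $ x"
    using x assms by (simp add: vec_of_mat_def a_def b_def)
  finally show "(kronecker U V *\<^sub>v vec_of_mat M) $ x = vec_of_mat (U * M * transpose_mat V) $ x" .
qed (use assms in \<open>auto simp: vec_of_mat_def kronecker_def\<close>)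

lemma gate_mat_Local_A:
  assumes "U \<in> carrier_mat (2 ^ k1) (2 ^ k1)" "M \<in> carrier_mat (2 ^ k1) (2 ^ k2)"
  shows "gate_mat k1 k2 (Local_A U) *\<^sub>v vec_of_mat M = vec_of_mat (U * M)"
  using kronecker_mult_vec_of_mat[OF assms(1) one_carrier_mat assms(2)] assms
  by (simp add: right_mult_one_mat[of _ "2 ^ k1" "2 ^ k2"])

lemma gate_mat_Local_B:
  assumes "V \<in> carrier_mat (2 ^ k2) (2 ^ k2)" "M \<in> carrier_mat (2 ^ k1) (2 ^ k2)"
  shows "gate_mat k1 k2 (Local_B V) *\<^sub>v vec_of_mat M = vec_of_mat (M * transpose_mat V)"
  using kronecker_mult_vec_of_mat[OF one_carrier_mat assms(1) assms(2)] assms by simp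

text \<open>Right multiplication of the amplitudes by \<open>V\<close> is effected by the B gate
  \<open>transpose_mat V\<close>, which must itself be unitary.\<close>

lemma unitary_transpose:
  assumes "unitary d V"
  shows "unitary d (transpose_mat V)"
proof (rule unitaryI)
  have V: "V \<in> carrier_mat d d" "V * mat_adjoint V = 1\<^sub>m d" using assms by (auto simp: unitary_def)
  have "mat_adjoint (transpose_mat V) = transpose_mat (mat_adjoint V)"
    by (rule eq_matI) auto
  also have "\<dots> * transpose_mat V = transpose_mat (V * mat_adjoint V)"
    using V by (intro transpose_mult[symmetric]) auto
  also have "\<dots> = 1\<^sub>m d" using V by simp
  finally show "mat_adjoint (transpose_mat V) * transpose_mat V = 1\<^sub>m d" .
qed (use assms in \<open>auto simp: unitary_def\<close>)

section \<open>The action of a CNOT gate on amplitudes\<close>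

lemma flip_bit_less_power:
  fixes x :: nat
  assumes "x < 2 ^ n" "b < n"
  shows "flip_bit b x < 2 ^ n"
proof -
  have "take_bit n x = x" using assms(1) by (simp add: take_bit_nat_eq_self_iff)
  then have "take_bit n (flip_bit b x) = flip_bit b x"
    using assms(2) by (simp add: take_bit_flip_bit_eq)
  then show ?thesis by (metis take_bit_nat_less_exp)
qed

lemma cnot_index_less:
  assumes "x < 2 ^ n" "t < n"
  shows "cnot_index n c t x < 2 ^ n"
  using assms flip_bit_less_power[of x n "n - 1 - t"] by (simp add: cnot_index_def)

lemma cnot_index_involution:
  assumes "c < n" "t < n" "c \<noteq> t"
  shows "cnot_index n c t (cnot_index n c t x) = x"
proof -
  \<comment> \<open>The bounds keep the truncated subtractions exact, so distinct qubits occupy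
    distinct bits and the control survives the flip of the target.\<close>
  have "n - 1 - c \<noteq> n - 1 - t" using assms by auto
  then show ?thesis
    by (auto simp: cnot_index_def bit_flip_bit_iff intro!: bit_eqI)
qed

text \<open>A permutation matrix moves amplitudes by the inverse permutation;
  \<open>cnot_index\<close> is its own inverse, so it appears here directly.\<close>

lemma cnot_mat_mult_vec:
  assumes "c < n" "t < n" "c \<noteq> t" "v \<in> carrier_vec (2 ^ n)" "x < 2 ^ n"
  shows "(cnot_mat n c t *\<^sub>v v) $ x = v $ cnot_index n c t x"
proof -
  have "(cnot_mat n c t *\<^sub>v v) $ x = (\<Sum>y<2 ^ n. (if x = cnot_index n c t y then 1 else 0) * v $ y)"
    using assms by (simp add: cnot_mat_def scalar_prod_def atLeast0LessThan)
  also have "\<dots> = (\<Sum>y<2 ^ n. if y = cnot_index n c t x then v $ y else 0)"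
    using cnot_index_involution[OF assms(1-3)] by (intro sum.cong) auto
  also have "\<dots> = v $ cnot_index n c t x"
    using cnot_index_less[OF assms(5,2), of c] by simp
  finally show ?thesis .
qed

section \<open>Bit arithmetic and the CNOT fan-out from A to B\<close>

lemma flip_bit_div_power:
  fixes x :: nat
  assumes "b < k"
  shows "flip_bit b x div 2 ^ k = x div 2 ^ k"
proof -
  have "drop_bit k (flip_bit b x) = drop_bit k x"
    using assms by (intro bit_eqI) (auto simp: bit_drop_bit_eq bit_flip_bit_iff)
  then show ?thesis by (simp add: drop_bit_eq_div)
qed

lemma flip_bit_mod_power:
  fixes x :: nat
  assumes "b < k"
  shows "flip_bit b x mod 2 ^ k = flip_bit b (x mod 2 ^ k)"
  using assms take_bit_flip_bit_eq[of k b x] by (simp add: take_bit_eq_mod)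

text \<open>When bit \<open>b\<close> of \<open>i\<close> is set, the involution
  \<open>flip_bit b\<close> exchanges the truncations of \<open>i\<close> to \<open>b\<close> and to
  \<open>Suc b\<close> bits. This is how one CNOT advances the support of the fan-out state.\<close>

lemma flip_bit_eq_take_bit_iff:
  fixes i j :: nat
  assumes "bit i b"
  shows "flip_bit b j = take_bit b i \<longleftrightarrow> j = take_bit (Suc b) i"
proof -
  have "flip_bit b (take_bit (Suc b) i) = take_bit b i"
    using assms by (intro bit_eqI) (auto simp: bit_flip_bit_iff bit_take_bit_iff less_Suc_eq)
  moreover have "flip_bit b (flip_bit b j) = j"
    by (intro bit_eqI) (auto simp: bit_flip_bit_iff)
  moreover have "flip_bit b (take_bit b i) = take_bit (Suc b) i"
    using assms by (intro bit_eqI) (auto simp: bit_flip_bit_iff bit_take_bit_iff less_Suc_eq)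
  ultimately show ?thesis by metis
qed

lemma take_bit_Suc_unset:
  fixes i :: nat
  assumes "\<not> bit i b"
  shows "take_bit (Suc b) i = take_bit b i"
  using assms by (intro bit_eqI) (auto simp: bit_take_bit_iff less_Suc_eq)

text \<open>Since qubit 0 is the most significant bit, the gate of step b acts on bit b of both indices.\<close>

definition fanout_mat :: "nat \<Rightarrow> nat \<Rightarrow> (nat \<Rightarrow> complex) \<Rightarrow> nat \<Rightarrow> complex mat" where
  "fanout_mat k1 k2 s b =
     mat (2 ^ k1) (2 ^ k2) (\<lambda>(i, j). if j = take_bit b i then s i else 0)"

definition fanout_gate :: "nat \<Rightarrow> nat \<Rightarrow> nat \<Rightarrow> gate" where
  "fanout_gate k1 k2 b = CNOT (k1 - 1 - b) (k1 + k2 - 1 - b)"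

text \<open>At stage \<open>b\<close> the low \<open>b\<close> bits of the A index have been copied
  into B and the other bits of B are still 0. The next gate flips bit \<open>b\<close> of the B
  index exactly when bit \<open>b\<close> of the A index is set, which copies one more bit.\<close>

lemma fanout_step:
  assumes "b < k1" "k1 \<le> k2"
  shows "gate_mat k1 k2 (fanout_gate k1 k2 b) *\<^sub>v vec_of_mat (fanout_mat k1 k2 s b)
       = vec_of_mat (fanout_mat k1 k2 s (Suc b))"
proof (rule eq_vecI)
  define n c t where "n = k1 + k2" and "c = k1 - 1 - b" and "t = k1 + k2 - 1 - b"
  \<comment> \<open>The control is bit \<open>k2 + b\<close> of the full index, which is bit
    \<open>b\<close> of its A part; the target is bit \<open>b\<close>, inside the B part since
    \<open>b < k2\<close>.\<close>
  have ct: "c < n" "t < n" "c \<noteq> t" "n - 1 - c = k2 + b" "n - 1 - t = b"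
    using assms by (auto simp: n_def c_def t_def)
  fix x assume "x < dim_vec (vec_of_mat (fanout_mat k1 k2 s (Suc b)))"
  then have x: "x < 2 ^ k1 * 2 ^ k2" "x < 2 ^ n"
    by (auto simp: vec_of_mat_def fanout_mat_def n_def power_add)
  define i j where "i = x div 2 ^ k2" and "j = x mod 2 ^ k2"
  have ij: "i < 2 ^ k1" "j < 2 ^ k2" using div_mod_less[OF x(1)] by (auto simp: i_def j_def)
  have bit: "bit x (k2 + b) = bit i b" by (simp add: i_def bit_drop_bit_eq flip: drop_bit_eq_div)
  define y where "y = cnot_index n c t x"
  have y: "y < 2 ^ n" using cnot_index_less x ct by (simp add: y_def)
  have y_eq: "y = (if bit i b then flip_bit b x else x)"
    by (simp only: y_def cnot_index_def ct(4,5) bit)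
  have y_div: "y div 2 ^ k2 = i" and y_mod: "y mod 2 ^ k2 = (if bit i b then flip_bit b j else j)"
    using assms unfolding y_eq i_def j_def
    by (simp_all only: flip_bit_div_power flip_bit_mod_power split: if_split) auto
  have "(gate_mat k1 k2 (fanout_gate k1 k2 b) *\<^sub>v vec_of_mat (fanout_mat k1 k2 s b)) $ x
      = vec_of_mat (fanout_mat k1 k2 s b) $ y"
  proof -
    have "gate_mat k1 k2 (fanout_gate k1 k2 b) = cnot_mat n c t"
      by (simp add: fanout_gate_def n_def c_def t_def)
    moreover have "vec_of_mat (fanout_mat k1 k2 s b) \<in> carrier_vec (2 ^ n)"
      by (intro carrier_vecI) (simp add: vec_of_mat_def fanout_mat_def n_def power_add)
    ultimately show ?thesis using cnot_mat_mult_vec[OF ct(1-3) _ x(2)] by (simp add: y_def)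
  qed
  also have "\<dots> = fanout_mat k1 k2 s b $$ (i, y mod 2 ^ k2)"
    using y by (simp add: vec_of_mat_def fanout_mat_def y_div n_def power_add)
  \<comment> \<open>If bit \<open>b\<close> of \<open>i\<close> is set, the flip exchanges the two
    truncations; if not, they coincide and nothing moves.\<close>
  also have "\<dots> = fanout_mat k1 k2 s (Suc b) $$ (i, j)"
    using ij assms flip_bit_less_power[of j k2 b]
    by (auto simp: fanout_mat_def y_mod flip_bit_eq_take_bit_iff take_bit_Suc_unset)
  also have "\<dots> = vec_of_mat (fanout_mat k1 k2 s (Suc b)) $ x"
    using x by (simp add: vec_of_mat_def fanout_mat_def i_def j_def)
  finally show "(gate_mat k1 k2 (fanout_gate k1 k2 b) *\<^sub>v vec_of_mat (fanout_mat k1 k2 s b)) $ x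
    = vec_of_mat (fanout_mat k1 k2 s (Suc b)) $ x" .
qed (simp add: fanout_gate_def cnot_mat_def vec_of_mat_def fanout_mat_def power_add)

lemma run_circuit_append:
  "run_circuit k1 k2 (gs @ hs) \<psi> = run_circuit k1 k2 hs (run_circuit k1 k2 gs \<psi>)"
  by (simp add: run_circuit_def)

lemma run_circuit_fanout:
  assumes "b \<le> k1" "k1 \<le> k2"
  shows "run_circuit k1 k2 (map (fanout_gate k1 k2) [0..<b]) (vec_of_mat (fanout_mat k1 k2 s 0))
       = vec_of_mat (fanout_mat k1 k2 s b)"
  using assms(1)
proof (induction b)
  case 0
  then show ?case by (simp add: run_circuit_def)
next
  case (Suc b)
  then show ?case using fanout_step[of b k1 k2 s] assms(2)
    by (simp add: run_circuit_append run_circuit_def)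
qed

section \<open>Assembling the circuit from the Schmidt decomposition\<close>

lemma exists_circuit_with_k1_cnots:
  assumes k: "k1 \<le> k2" and \<psi>: "pure_state (k1 + k2) \<psi>"
  obtains gs where "bipartite_circuit k1 k2 gs" "run_circuit k1 k2 gs (zero_state (k1 + k2)) = \<psi>"
    "straddling_count gs = k1"
proof -
  define m n :: nat where "m = 2 ^ k1" and "n = 2 ^ k2"
  have mn: "m \<le> n" "0 < m" "0 < n" using k by (auto simp: m_def n_def)
  have \<psi>c: "\<psi> \<in> carrier_vec (m * n)" "\<psi> \<bullet>c \<psi> = 1"
    using \<psi> by (auto simp: pure_state_def m_def n_def power_add)
  define M where "M = mat m n (\<lambda>(i, j). \<psi> $ (i * n + j))"
  have Mc: "M \<in> carrier_mat m n" by (simp add: M_def)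
  have vec_M: "vec_of_mat M = \<psi>"
    using \<psi>c div_mod_less[of _ m n] by (intro eq_vecI) (auto simp: vec_of_mat_def M_def)
  obtain U V s where U: "unitary m U" and V: "unitary n V"
    and M: "M = U * mat m n (\<lambda>(i, j). if i = j then s i else 0) * V"
    and s: "(\<Sum>i<m. s i * cnj (s i)) = (\<Sum>j<n. col M j \<bullet>c col M j)"
    by (rule singular_value_decomposition[OF Mc mn(1)]) blast
  \<comment> \<open>The squared Frobenius norm of \<open>M\<close> is the squared norm of
    \<open>\<psi>\<close>, so \<open>vec m s\<close> is a unit vector and can be prepared on A
    alone.\<close>
  have "(\<Sum>j<n. col M j \<bullet>c col M j) = (\<Sum>j<n. \<Sum>i<m. \<psi> $ (i * n + j) * cnj (\<psi> $ (i * n + j)))"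
    by (auto simp: M_def scalar_prod_def atLeast0LessThan intro!: sum.cong)
  also have "\<dots> = (\<Sum>i<m. \<Sum>j<n. \<psi> $ (i * n + j) * cnj (\<psi> $ (i * n + j)))" by (rule sum.swap)
  also have "\<dots> = (\<Sum>x<m * n. \<psi> $ x * cnj (\<psi> $ x))" by (simp add: sum_lessThan_mult)
  also have "\<dots> = \<psi> \<bullet>c \<psi>" using \<psi>c(1) by (simp add: scalar_prod_def atLeast0LessThan)
  finally have "(\<Sum>i<m. s i * cnj (s i)) = 1" using s \<psi>c by simp
  then have "vec m s \<bullet>c vec m s = 1" by (simp add: scalar_prod_def atLeast0LessThan)
  then obtain P where P: "unitary m P" "col P 0 = vec m s"
    using unitary_first_column[of "vec m s" m] mn by auto
  have Uc: "U \<in> carrier_mat m m" and Vc: "V \<in> carrier_mat n n" and Pc: "P \<in> carrier_mat m m"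
    using U V P by (auto simp: unitary_def)
  define E where "E = mat m n (\<lambda>(i, j). if i = 0 \<and> j = 0 then 1 else 0 :: complex)"
  have Ec: "E \<in> carrier_mat m n" by (simp add: E_def)
  have zero: "zero_state (k1 + k2) = vec_of_mat E"
  proof (rule eq_vecI)
    fix x assume "x < dim_vec (vec_of_mat E)"
    then have x: "x < m * n" by (simp add: vec_of_mat_def E_def)
    have "x = 0 \<longleftrightarrow> x div n = 0 \<and> x mod n = 0" using div_mult_mod_eq[of x n] by (metis add_0 div_0 mod_0 mult_0)
    then show "zero_state (k1 + k2) $ x = vec_of_mat E $ x"
      using x div_mod_less[OF x]
      by (simp add: vec_of_mat_def E_def zero_state_def m_def n_def power_add unit_vec_def)
  qed (simp add: vec_of_mat_def E_def zero_state_def m_def n_def power_add)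
  \<comment> \<open>\<open>E\<close> has its only nonzero entry at (0, 0), so \<open>P * E\<close>
    carries the first column of \<open>P\<close>, namely \<open>s\<close>, in column 0. This is
    fan-out stage 0, as \<open>take_bit 0 i = 0\<close>.\<close>
  have PE: "P * E = fanout_mat k1 k2 s 0"
  proof (rule eq_matI)
    fix i j assume "i < dim_row (fanout_mat k1 k2 s 0)" "j < dim_col (fanout_mat k1 k2 s 0)"
    then have ij: "i < m" "j < n" by (auto simp: fanout_mat_def m_def n_def)
    have "(P * E) $$ (i, j) = (\<Sum>l<m. P $$ (i, l) * (if l = 0 \<and> j = 0 then 1 else 0))"
      using ij Pc by (simp add: E_def scalar_prod_def atLeast0LessThan)
    also have "\<dots> = (\<Sum>l<m. if l = 0 then (if j = 0 then P $$ (i, 0) else 0) else 0)"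
      by (intro sum.cong) auto
    also have "\<dots> = (if j = 0 then P $$ (i, 0) else 0)" using mn by simp
    also have "P $$ (i, 0) = col P 0 $ i" using ij Pc mn by simp
    also have "\<dots> = s i" using ij P by simp
    finally show "(P * E) $$ (i, j) = fanout_mat k1 k2 s 0 $$ (i, j)"
      using ij by (simp add: fanout_mat_def m_def n_def)
  qed (use Pc in \<open>auto simp: fanout_mat_def E_def m_def n_def\<close>)
  \<comment> \<open>After \<open>k1\<close> steps the whole A index has been copied:
    \<open>take_bit k1 i = i\<close> for \<open>i < 2 ^ k1\<close>, so the amplitude matrix is
    diagonal.\<close>
  have D: "fanout_mat k1 k2 s k1 = mat m n (\<lambda>(i, j). if i = j then s i else 0)"
    by (intro eq_matI) (auto simp: fanout_mat_def m_def n_def take_bit_nat_eq_self)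
  let ?F = "map (fanout_gate k1 k2) [0..<k1]"
  define gs where "gs = [Local_A P] @ ?F @ [Local_A U, Local_B (transpose_mat V)]"
  have "run_circuit k1 k2 gs (zero_state (k1 + k2))
      = run_circuit k1 k2 [Local_A U, Local_B (transpose_mat V)]
          (run_circuit k1 k2 ?F (gate_mat k1 k2 (Local_A P) *\<^sub>v vec_of_mat E))"
    by (simp only: gs_def run_circuit_append zero) (simp add: run_circuit_def)
  also have "gate_mat k1 k2 (Local_A P) *\<^sub>v vec_of_mat E = vec_of_mat (fanout_mat k1 k2 s 0)"
    using gate_mat_Local_A[of P k1 E k2] Pc Ec PE by (simp add: m_def n_def)
  also have "run_circuit k1 k2 ?F \<dots> = vec_of_mat (fanout_mat k1 k2 s k1)"
    using run_circuit_fanout[OF order_refl k] .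
  also have "run_circuit k1 k2 [Local_A U, Local_B (transpose_mat V)] \<dots>
      = gate_mat k1 k2 (Local_B (transpose_mat V)) *\<^sub>v vec_of_mat (U * fanout_mat k1 k2 s k1)"
    using gate_mat_Local_A[of U k1 "fanout_mat k1 k2 s k1" k2] Uc
    by (simp add: run_circuit_def m_def fanout_mat_def)
  also have "\<dots> = vec_of_mat (U * fanout_mat k1 k2 s k1 * V)"
  proof -
    have "U * fanout_mat k1 k2 s k1 \<in> carrier_mat m n"
      unfolding D using Uc by (intro carrier_matI) auto
    then show ?thesis
      using gate_mat_Local_B[of "transpose_mat V" k2 "U * fanout_mat k1 k2 s k1" k1] Vc
      by (simp add: m_def n_def)
  qed
  also have "\<dots> = \<psi>" using M vec_M D by simp
  finally have run: "run_circuit k1 k2 gs (zero_state (k1 + k2)) = \<psi>" .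
  have "bipartite_circuit k1 k2 gs"
    using U P unitary_transpose[OF V] k
    by (auto simp: bipartite_circuit_def gs_def fanout_gate_def m_def n_def)
  moreover have "straddling_count gs = k1"
    by (simp add: straddling_count_def gs_def fanout_gate_def filter_map o_def)
  ultimately show ?thesis using run that by blast
qed

theorem mainTheorem2:
  shows "\<exists>C::real. C > 0 \<and>
    (\<forall>k1 k2 \<psi>. 0 < k1 \<and> k1 \<le> k2 \<and> pure_state (k1 + k2) \<psi> \<longrightarrow>
      (\<exists>gs. bipartite_circuit k1 k2 gs \<and>
            run_circuit k1 k2 gs (zero_state (k1 + k2)) = \<psi> \<and>
            real (straddling_count gs) \<le> C * 2 ^ k1))"
\<comment> \<open>The constant 1 works because \<open>k1\<close> straddling gates are used and
  \<open>k1 < 2 ^ k1\<close>.\<close>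
proof (intro exI[of _ 1] conjI allI impI)
  fix k1 k2 :: nat and \<psi>
  assume "0 < k1 \<and> k1 \<le> k2 \<and> pure_state (k1 + k2) \<psi>"
  then obtain gs where gs: "bipartite_circuit k1 k2 gs"
    "run_circuit k1 k2 gs (zero_state (k1 + k2)) = \<psi>" "straddling_count gs = k1"
    using exists_circuit_with_k1_cnots by blast
  have "real k1 \<le> 2 ^ k1" using of_nat_less_two_power[of k1, where 'a = real] by simp
  then show "\<exists>gs. bipartite_circuit k1 k2 gs \<and>
      run_circuit k1 k2 gs (zero_state (k1 + k2)) = \<psi> \<and> real (straddling_count gs) \<le> 1 * 2 ^ k1"
    using gs by auto
qed simp

end
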